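(* Let $n \geq 1$ be an integer and let $\kappa\in(0,1)\cap\mathbb{Q}$ be such that $\Gamma(\kappa)$ is transcendental. Then: (i) $\#\left\{ \widetilde{m}\in\mathcal{L}_{\kappa}^{(+)}(\infty) : \Gamma^{(n)}(\widetilde{m})\ \text{is algebraic}\right\} \leq n$; and (ii) $\#\left\{ \widetilde{m}\in\mathcal{L}_{\kappa}^{(-)}(\infty) : \Gamma^{(n)}(\widetilde{m})\ \text{is algebraic}\right\} \leq n$.
   Context: $\Gamma$ denotes the Euler Gamma function (meromorphically continued, with poles only at the non-positive integers) and $\Gamma^{(n)}$ its $n$-th derivative. "Algebraic" and "transcendental" are over $\mathbb{Q}$. $\#$ denotes the cardinality of a set (in particular the claim includes that the sets are finite). The one-sided shifted lattices are $\mathcal{L}_{\kappa}^{(+)}(\infty)=\{m+\kappa : m\in\mathbb{Z}_{\geq 0}\}=\{\kappa,1+\kappa,2+\kappa,\ldots\}$ and $\mathcal{L}_{\kappa}^{(-)}(\infty)=\{-m+\kappa : m\in\mathbb{Z}_{\geq 0}\}=\{\kappa,-1+\kappa,-2+\kappa,\ldots\}$. *)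

theory Defs
  imports "HOL-Complex_Analysis.Complex_Analysis" "HOL-Computational_Algebra.Polynomial"
begin

definition lattice_plus :: "real \<Rightarrow> complex set" where
  "lattice_plus \<kappa> = {of_nat m + of_real \<kappa> | m. True}"

definition lattice_minus :: "real \<Rightarrow> complex set" where
  "lattice_minus \<kappa> = {- of_nat m + of_real \<kappa> | m. True}"

text \<open>
  The library predicate \<^const>\<open>algebraic\<close> asks for a nonzero annihilating polynomial with integer
  coefficients, which is algebraicity over the rationals.
\<close>

abbreviation transcendental :: "complex \<Rightarrow> bool" where
  "transcendental z \<equiv> \<not> algebraic z"

end

theory Submission
  imports Defs
begin

text \<open>
  The algebraic numbers form a \<open>\<rat>\<close>-subspace of \<open>\<complex>\<close>, so if \<open>\<Gamma>(\<kappa>)\<close> is transcendental there is a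
  \<open>\<rat>\<close>-linear map \<open>\<phi> : \<complex> \<rightarrow> \<rat>\<close> that vanishes on all algebraic numbers and takes the value
  \<open>1\<close> at \<open>\<Gamma>(\<kappa>)\<close> (lemma \<open>rat_functional_separating_algebraic\<close>). Write \<open>\<Gamma>\<^sub>k\<close> for the \<open>k\<close>-th
  derivative. Differentiating \<open>\<Gamma>(z + 1) = z \<Gamma>(z)\<close> gives
  \<open>\<Gamma>\<^sub>k(z + 1) = z \<Gamma>\<^sub>k(z) + k \<Gamma>\<^sub>k\<^sub>-\<^sub>1(z)\<close>, whose coefficients are rational for \<open>z \<in> \<kappa> + \<int>\<close>. Hence
  the rational numbers \<open>\<phi>(\<Gamma>\<^sub>k(z))\<close> obey the same recurrence on \<open>\<kappa> + \<int>\<close>, and every point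
  where \<open>\<Gamma>\<^sub>n\<close> is algebraic is a zero of \<open>\<phi> \<circ> \<Gamma>\<^sub>n\<close>. It remains to see that \<open>\<phi> \<circ> \<Gamma>\<^sub>n\<close> has at
  most \<open>n\<close> zeros on each of the two half-lattices.

  Take the upper one and put \<open>u\<^sub>k(m) = \<phi>(\<Gamma>\<^sub>k(\<kappa> + m))\<close>. For \<open>k = 0\<close> the recurrence reads
  \<open>u\<^sub>0(m + 1) = (\<kappa> + m) u\<^sub>0(m)\<close>. Dividing every \<open>u\<^sub>k(m)\<close> by the product \<open>\<kappa> (\<kappa> + 1) \<dots> (\<kappa> + m - 1)\<close>
  produces sequences \<open>v\<^sub>k\<close> with the same zeros for which \<open>v\<^sub>0\<close> is a nonzero constant and the
  forward difference of \<open>v\<^sub>k\<close> is a positive multiple of \<open>v\<^sub>k\<^sub>-\<^sub>1\<close>. This calls for a discrete Rolle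
  theorem: between two weak sign changes of a sequence its difference has a weak sign
  change of its own. So \<open>n + 1\<close> zeros of \<open>v\<^sub>n\<close>, which may be read as alternating weakly in sign
  in either of two ways, would leave, \<open>n\<close> differences later, a point where \<open>v\<^sub>0\<close> has whichever
  weak sign one likes; this is absurd for a nonzero constant
  (lemma \<open>card_zeros_difference_ladder\<close>). The lower half-lattice differs only in the
  normalising product.
\<close>

section \<open>Algebraic numbers as a rational subspace\<close>

interpretation rat_space: vector_space "\<lambda>r (x::complex). of_rat r * x"
  by unfold_locales (simp_all add: algebra_simps of_rat_add of_rat_mult)

lemma rat_space_span_mult:
  assumes "x \<in> rat_space.span A" and "y \<in> rat_space.span B"
  shows "x * y \<in> rat_space.span ((\<lambda>(a, b). a * b) ` (A \<times> B))" (is "_ \<in> rat_space.span ?AB")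
proof -
  have base: "a * y \<in> rat_space.span ?AB" if "a \<in> A" for a
    using assms(2)
  proof (induction rule: rat_space.span_induct_alt)
    case base
    show ?case by (simp add: rat_space.span_zero)
  next
    case (step c b w)
    have "a * b \<in> rat_space.span ?AB"
      using step that by (intro rat_space.span_base) force
    from rat_space.span_add[OF rat_space.span_scale[OF this] step(2)] show ?case
      by (simp add: algebra_simps)
  qed
  show ?thesis
    using assms(1)
  proof (induction rule: rat_space.span_induct_alt)
    case base
    show ?case by (simp add: rat_space.span_zero)
  next
    case (step c a w)
    from rat_space.span_add[OF rat_space.span_scale[OF base[OF step(1)]] step(2)] show ?case
      by (simp add: algebra_simps)
  qed
qed

text \<open>
  Dividing by the leading coefficient of an annihilating polynomial of degree \<open>d\<close> expresses
  \<open>x\<^sup>d\<close>, and hence by recursion every power, through the \<open>d\<close> lowest ones.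
\<close>

lemma powers_in_finite_span_if_algebraic:
  fixes x :: complex
  assumes "algebraic x"
  obtains T where "finite T" and "\<And>k. x ^ k \<in> rat_space.span T"
proof -
  obtain p :: "int poly" where p: "p \<noteq> 0" "poly (map_poly of_int p) x = 0"
    using algebraicE'[OF assms] .
  define d where "d = degree p"
  let ?T = "(\<lambda>i. x ^ i) ` {..<d}"
  have lc: "coeff p d \<noteq> 0" using p(1) by (simp add: d_def)
  have root: "(\<Sum>i\<le>d. of_int (coeff p i) * x ^ i) = 0"
    using p(2) by (simp add: poly_altdef d_def degree_map_poly coeff_map_poly)
  have "x ^ k \<in> rat_space.span ?T" for k
  proof (induction k rule: less_induct)
    case (less k)
    show ?case
    proof (cases "k < d")
      case True
      then show ?thesis by (intro rat_space.span_base) simp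
    next
      case False
      have "of_int (coeff p d) * x ^ d = - (\<Sum>i<d. of_int (coeff p i) * x ^ i)"
        using root by (simp add: lessThan_Suc_atMost[symmetric] eq_neg_iff_add_eq_0 add.commute)
      then have "of_int (coeff p d) * x ^ d * x ^ (k - d)
          = - (\<Sum>i<d. of_int (coeff p i) * x ^ i) * x ^ (k - d)" by simp
      moreover have "x ^ d * x ^ (k - d) = x ^ k"
        using False by (simp add: power_add[symmetric])
      ultimately have "of_int (coeff p d) * x ^ k
          = - (\<Sum>i<d. of_int (coeff p i) * x ^ (i + (k - d)))"
        by (simp add: sum_distrib_right power_add mult.assoc)
      then have "x ^ k = - (\<Sum>i<d. of_int (coeff p i) * x ^ (i + (k - d))) / of_int (coeff p d)"
        using lc by (simp add: field_simps)
      then have "x ^ k = (\<Sum>i<d. of_rat (- (of_int (coeff p i) / of_int (coeff p d)))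
          * x ^ (i + (k - d)))"
        by (simp add: of_rat_divide of_rat_minus sum_negf sum_divide_distrib)
      moreover have "\<dots> \<in> rat_space.span ?T"
        using False by (intro rat_space.span_sum rat_space.span_scale less) auto
      ultimately show ?thesis by simp
    qed
  qed
  then show thesis by (intro that[of ?T]) auto
qed

lemma algebraic_if_powers_in_finite_span:
  fixes x :: complex
  assumes "finite T" and "\<And>k. x ^ k \<in> rat_space.span T"
  shows "algebraic x"
proof (cases "inj (\<lambda>k. x ^ k)")
  case False
  then obtain i j where ij: "i \<noteq> j" "x ^ i = x ^ j" by (auto simp: inj_def)
  have "coeff (monom (1::complex) i - monom 1 j) i \<noteq> 0" using ij by simp
  then have "monom (1::complex) i - monom 1 j \<noteq> 0" by (metis coeff_0)
  then show ?thesis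
    using ij by (intro algebraicI'[of "monom 1 i - monom 1 j"]) (auto simp: poly_monom)
next
  case True
  have "infinite (range (\<lambda>k. x ^ k))"
    using True finite_imageD by blast
  then have "rat_space.dependent (range (\<lambda>k. x ^ k))"
    using rat_space.independent_span_bound[OF assms(1)] assms(2) by blast
  then obtain S u where S: "finite S" "S \<subseteq> range (\<lambda>k. x ^ k)"
      "(\<Sum>v\<in>S. of_rat (u v) * v) = 0" "\<exists>v\<in>S. u v \<noteq> 0"
    unfolding rat_space.dependent_explicit by blast
  from S(1,2) obtain I where I: "finite I" "S = (\<lambda>k. x ^ k) ` I"
    by (meson finite_subset_image)
  define p where "p = (\<Sum>k\<in>I. monom (of_rat (u (x ^ k)) :: complex) k)"
  have coeff: "coeff p i = (if i \<in> I then of_rat (u (x ^ i)) else 0)" for i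
    using I(1) by (simp add: p_def coeff_sum)
  have "poly p x = (\<Sum>k\<in>I. of_rat (u (x ^ k)) * x ^ k)"
    by (simp add: p_def poly_sum poly_monom)
  also have "\<dots> = (\<Sum>v\<in>S. of_rat (u v) * v)"
    unfolding I(2) using True by (subst sum.reindex) (auto intro: inj_on_subset)
  finally have "poly p x = 0" using S(3) by simp
  moreover obtain k where "k \<in> I" "u (x ^ k) \<noteq> 0" using S(4) I(2) by blast
  then have "coeff p k \<noteq> 0" by (simp add: coeff)
  then have "p \<noteq> 0" by auto
  ultimately show ?thesis
    by (intro algebraicI'[of p]) (auto simp: coeff)
qed

text \<open>
  By the binomial theorem the powers of \<open>x + y\<close> lie in the span of the products of the finitely
  many vectors that generate the powers of \<open>x\<close> and those of \<open>y\<close>.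
\<close>

lemma algebraic_add:
  fixes x y :: complex
  assumes "algebraic x" and "algebraic y"
  shows "algebraic (x + y)"
proof -
  obtain A where A: "finite A" "\<And>k. x ^ k \<in> rat_space.span A"
    using powers_in_finite_span_if_algebraic[OF assms(1)] by blast
  obtain B where B: "finite B" "\<And>k. y ^ k \<in> rat_space.span B"
    using powers_in_finite_span_if_algebraic[OF assms(2)] by blast
  let ?AB = "(\<lambda>(a, b). a * b) ` (A \<times> B)"
  have "(x + y) ^ k \<in> rat_space.span ?AB" for k
  proof -
    have "(x + y) ^ k = (\<Sum>i\<le>k. of_rat (of_nat (k choose i)) * (x ^ i * y ^ (k - i)))"
      by (simp add: binomial_ring mult.assoc)
    also have "\<dots> \<in> rat_space.span ?AB"
      by (intro rat_space.span_sum rat_space.span_scale rat_space_span_mult A B)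
    finally show ?thesis .
  qed
  then show ?thesis
    using A(1) B(1) by (intro algebraic_if_powers_in_finite_span[of ?AB]) auto
qed

lemma algebraic_of_rat_mult:
  fixes x :: complex
  assumes "algebraic x"
  shows "algebraic (of_rat r * x)"
proof -
  obtain A where A: "finite A" "\<And>k. x ^ k \<in> rat_space.span A"
    using powers_in_finite_span_if_algebraic[OF assms] by blast
  have "(of_rat r * x) ^ k \<in> rat_space.span A" for k
    using rat_space.span_scale[OF A(2), of "r ^ k" k]
    by (simp add: power_mult_distrib of_rat_power)
  with A(1) show ?thesis by (rule algebraic_if_powers_in_finite_span)
qed

lemma rat_subspace_algebraic: "rat_space.subspace {x. algebraic x}"
  by (rule rat_space.subspaceI) (auto intro: algebraic_add algebraic_of_rat_mult)

text \<open>
  A transcendental number lies outside the subspace of algebraic numbers, so a basis of that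
  subspace stays independent when the number is adjoined, and coordinates may be prescribed.
\<close>

lemma rat_functional_separating_algebraic:
  fixes x :: complex
  assumes "\<not> algebraic x"
  obtains \<phi> :: "complex \<Rightarrow> rat" where
    "\<And>y z. \<phi> (y + z) = \<phi> y + \<phi> z" and "\<And>r y. \<phi> (of_rat r * y) = r * \<phi> y"
    and "\<And>y. algebraic y \<Longrightarrow> \<phi> y = 0" and "\<phi> x = 1"
proof -
  interpret pair: vector_space_pair "\<lambda>r (x::complex). of_rat r * x" "(*) :: rat \<Rightarrow> rat \<Rightarrow> rat"
    by unfold_locales
  obtain B where B: "B \<subseteq> {x. algebraic x}" "rat_space.independent B"
      "{x. algebraic x} \<subseteq> rat_space.span B"
    by (rule rat_space.maximal_independent_subset)
  have span: "rat_space.span B = {x. algebraic x}"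
    using B rat_space.span_minimal[OF B(1) rat_subspace_algebraic] by blast
  have "rat_space.independent (insert x B)"
    using B(2) span assms by (intro rat_space.independent_insertI) auto
  from pair.linear_independent_extend[OF this, of "\<lambda>v. if v = x then 1 else 0"]
  obtain \<phi> where lin: "Vector_Spaces.linear (\<lambda>r (x::complex). of_rat r * x) ((*) :: rat \<Rightarrow> _) \<phi>"
    and val: "\<forall>v\<in>insert x B. \<phi> v = (if v = x then 1 else 0)" by blast
  interpret \<phi>: Vector_Spaces.linear "\<lambda>r (x::complex). of_rat r * x" "(*) :: rat \<Rightarrow> rat \<Rightarrow> rat" \<phi>
    by (fact lin)
  show thesis
  proof (rule that)
    show "\<phi> y = 0" if "algebraic y" for y
    proof -
      have "y \<in> rat_space.span B" using that span by auto
      moreover have "\<phi> b = 0" if "b \<in> B" for b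
        using that val B(1) assms by auto
      ultimately show ?thesis by (rule \<phi>.eq_0_on_span[rotated])
    qed
    show "\<phi> x = 1" using val by simp
  qed (fact \<phi>.add \<phi>.scale)+
qed

section \<open>A discrete Rolle argument\<close>

lemma nonincreasing_step_exists:
  fixes f :: "nat \<Rightarrow> 'a::linorder"
  assumes "a < b" and "f b \<le> f a"
  obtains l where "a \<le> l" and "l < b" and "f (Suc l) \<le> f l"
proof (rule ccontr)
  assume "\<not> thesis"
  with that have step: "f l < f (Suc l)" if "a \<le> l" "l < b" for l
    using that by (meson not_le)
  have "c \<le> b \<Longrightarrow> f a < f c" if "Suc a \<le> c" for c
    using that
  proof (induction c rule: dec_induct)
    case base
    then show ?case using step[of a] by simp
  next
    case (step c)
    then show ?case using \<open>\<And>l. a \<le> l \<Longrightarrow> l < b \<Longrightarrow> f l < f (Suc l)\<close>[of c]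
      by (meson Suc_leD Suc_le_lessD less_trans)
  qed
  from this[of b] assms show False by simp
qed

text \<open>
  The sequences \<open>v 0, v 1, v 2, \<dots>\<close> form a ladder: each is, up to positive weights and a
  reindexing \<open>g\<close>, the forward difference of the next. Weak alternation of signs at \<open>k + 1\<close> points
  is the property that the difference operator passes down, at the cost of one point; unlike
  plain zeros it needs no separate treatment of vanishing values and plateaus. The factor \<open>t\<close>
  carries the overall sign, which flips at every descent.
\<close>

lemma weak_alternation_descends:
  fixes v :: "nat \<Rightarrow> nat \<Rightarrow> 'a::linordered_field" and m :: "nat \<Rightarrow> nat"
  assumes const: "\<And>i. v 0 i = c"
    and diff: "\<And>k i. v (Suc k) (Suc i) - v (Suc k) i = a k i * v k (g i)"
    and pos: "\<And>k i. a k i > 0"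
    and g: "strict_mono g"
    and mono: "\<And>i. i < k \<Longrightarrow> m i < m (Suc i)"
    and alt: "\<And>i. i \<le> k \<Longrightarrow> 0 \<le> t * (-1) ^ i * v k (m i)"
  shows "0 \<le> t * (-1) ^ k * c"
  using mono alt
proof (induction k arbitrary: t m)
  case 0
  then show ?case using const by auto
next
  case (Suc k)
  have "\<exists>l. m i \<le> l \<and> l < m (Suc i) \<and> 0 \<le> - t * (-1) ^ i * v k (g l)" if "i \<le> k" for i
  proof -
    let ?f = "\<lambda>j. t * (-1) ^ i * v (Suc k) j"
    have "?f (m (Suc i)) \<le> ?f (m i)"
      using Suc.prems(2)[of i] Suc.prems(2)[of "Suc i"] that by simp
    moreover have "m i < m (Suc i)" using Suc.prems(1) that by simp
    ultimately
    obtain l where l: "m i \<le> l" "l < m (Suc i)" "?f (Suc l) \<le> ?f l"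
      using nonincreasing_step_exists[of "m i" "m (Suc i)" ?f] by blast
    have "t * (-1) ^ i * (v (Suc k) (Suc l) - v (Suc k) l) \<le> 0"
      using l(3) by (simp add: right_diff_distrib)
    then have "a k l * (t * (-1) ^ i * v k (g l)) \<le> 0"
      unfolding diff by (simp only: mult.left_commute)
    then have "t * (-1) ^ i * v k (g l) \<le> 0"
      using pos[of k l] by (simp only: mult_le_0_iff) auto
    then show ?thesis using l by auto
  qed
  then obtain l where l: "\<And>i. i \<le> k \<Longrightarrow> m i \<le> l i" "\<And>i. i \<le> k \<Longrightarrow> l i < m (Suc i)"
      "\<And>i. i \<le> k \<Longrightarrow> 0 \<le> - t * (-1) ^ i * v k (g (l i))"
    by metis
  have "g (l i) < g (l (Suc i))" if "i < k" for i
    using strict_monoD[OF g] l(2)[of i] l(1)[of "Suc i"] that by (simp add: less_le_trans)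
  from Suc.IH[of "\<lambda>i. g (l i)" "- t", OF this l(3)] show ?case by simp
qed

lemma card_zeros_difference_ladder:
  fixes v :: "nat \<Rightarrow> nat \<Rightarrow> 'a::linordered_field"
  assumes const: "\<And>i. v 0 i = c" and "c \<noteq> 0"
    and diff: "\<And>k i. v (Suc k) (Suc i) - v (Suc k) i = a k i * v k (g i)"
    and pos: "\<And>k i. a k i > 0"
    and g: "strict_mono g"
  shows "finite {i. v n i = 0} \<and> card {i. v n i = 0} \<le> n"
proof (rule ccontr)
  assume "\<not> ?thesis"
  then obtain Z where Z: "finite Z" "card Z = Suc n" "Z \<subseteq> {i. v n i = 0}"
    by (metis infinite_arbitrarily_large not_less_eq_eq obtain_subset_with_card_n)
  define m where "m = enumerate Z"
  have "m i < m (Suc i)" if "i < n" for i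
    unfolding m_def using Z that by (intro finite_enumerate_step) auto
  moreover have "v n (m i) = 0" if "i \<le> n" for i
    using finite_enumerate_in_set[of Z i] Z that by (auto simp: m_def)
  \<comment> \<open>Zeros alternate weakly for either choice of sign; this one contradicts the sign of \<open>c\<close>.\<close>
  ultimately have "0 \<le> (- ((-1) ^ n * c)) * (-1) ^ n * c"
    by (intro weak_alternation_descends[of v c a g n m, OF const diff pos g]) auto
  then have "c * c \<le> 0"
    by (simp add: algebra_simps power_mult_distrib[symmetric])
  with \<open>c \<noteq> 0\<close> show False by (auto simp: mult_le_0_iff)
qed

text \<open>
  Going up from \<open>q > 0\<close> the factors \<open>q + i\<close> are positive; dividing by their product
  makes the homogeneous part of the recurrence constant.
\<close>

lemma card_zeros_upward_recurrence:
  fixes u :: "nat \<Rightarrow> nat \<Rightarrow> 'a::linordered_field"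
  assumes "q > 0" and "u 0 0 \<noteq> 0"
    and rec: "\<And>k i. u k (Suc i) = (q + of_nat i) * u k i + of_nat k * u (k - 1) i"
  shows "finite {i. u n i = 0} \<and> card {i. u n i = 0} \<le> n"
proof -
  define v where "v k i = u k i / pochhammer q i" for k i
  have poch: "pochhammer q i > 0" for i using \<open>q > 0\<close> by (rule pochhammer_pos)
  have pos: "q + of_nat i > 0" for i :: nat using \<open>q > 0\<close> by (simp add: add_pos_nonneg)
  have step: "v k (Suc i) = v k i + of_nat k / (q + of_nat i) * v (k - 1) i" for k i
  proof -
    have "(s * x + y) / (p * s) = x / p + 1 / s * (y / p)" if "p > 0" "s > 0" for p s x y :: 'a
      using that by (simp add: field_simps)
    from this[OF poch[of i] pos[of i]] show ?thesis
      unfolding v_def rec pochhammer_Suc by simp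
  qed
  have "finite {i. v n i = 0} \<and> card {i. v n i = 0} \<le> n"
  proof (rule card_zeros_difference_ladder)
    show "v 0 i = u 0 0" for i
      by (induction i) (simp_all add: step, simp add: v_def)
    show "v (Suc k) (Suc i) - v (Suc k) i = (of_nat (Suc k) / (q + of_nat i)) * v k (id i)" for k i
      by (simp add: step)
  qed (use \<open>u 0 0 \<noteq> 0\<close> pos in \<open>auto simp: strict_mono_def simp del: of_nat_Suc\<close>)
  moreover have "v n i = 0 \<longleftrightarrow> u n i = 0" for i
    using poch[of i] by (simp add: v_def)
  ultimately show ?thesis by simp
qed

text \<open>
  Going down from \<open>q < 1\<close>, multiplying by the product \<open>D i\<close> of the factors \<open>q - 1 - j\<close> over
  \<open>j < i\<close> makes the homogeneous part constant. The recurrence gives the value at the lower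
  index in terms of the higher one, so the difference is a negative multiple of \<open>D i\<close>
  times the previous sequence at \<open>Suc i\<close>; as \<open>D i\<close> and \<open>D (Suc i)\<close> have opposite signs, the weight
  on the normalised sequence is positive after all.
\<close>

lemma card_zeros_downward_recurrence:
  fixes u :: "nat \<Rightarrow> nat \<Rightarrow> 'a::linordered_field"
  assumes "q < 1" and "u 0 0 \<noteq> 0"
    and rec: "\<And>k i. u k i = (q - of_nat (Suc i)) * u k (Suc i) + of_nat k * u (k - 1) (Suc i)"
  shows "finite {i. u n i = 0} \<and> card {i. u n i = 0} \<le> n"
proof -
  define D where "D i = (\<Prod>j<i. q - of_nat (Suc j))" for i
  define v where "v k i = D i * u k i" for k i
  have pos: "of_nat (Suc i) - q > 0" for i
    using less_le_trans[OF \<open>q < 1\<close>, of "1 + of_nat i"] by simp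
  have D0: "D i \<noteq> 0" for i using pos by (force simp: D_def)
  have DSuc: "D (Suc i) = D i * (q - of_nat (Suc i))" for i by (simp add: D_def)
  have step: "v k (Suc i) = v k i + of_nat k / (of_nat (Suc i) - q) * v (k - 1) (Suc i)" for k i
  proof -
    have "v k i = v k (Suc i) + of_nat k * D i * u (k - 1) (Suc i)"
      unfolding v_def DSuc by (subst rec) (simp add: algebra_simps)
    moreover have "D i = - (D (Suc i) / (of_nat (Suc i) - q))"
      using pos[of i] unfolding DSuc by (simp add: field_simps del: of_nat_Suc)
    ultimately show ?thesis by (simp add: v_def del: of_nat_Suc)
  qed
  have "finite {i. v n i = 0} \<and> card {i. v n i = 0} \<le> n"
  proof (rule card_zeros_difference_ladder)
    show "v 0 i = u 0 0" for i
    proof -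
      have "v 0 (Suc i) = v 0 i" for i using step[of 0 i] by simp
      then have "v 0 i = v 0 0" by (induction i) simp_all
      then show ?thesis by (simp add: v_def D_def)
    qed
    show "v (Suc k) (Suc i) - v (Suc k) i
        = (of_nat (Suc k) / (of_nat (Suc i) - q)) * v k (Suc i)" for k i
      using step[of "Suc k" i] by (simp del: of_nat_Suc)
  qed (use \<open>u 0 0 \<noteq> 0\<close> pos in \<open>auto simp: strict_mono_def simp del: of_nat_Suc\<close>)
  then show ?thesis by (simp add: v_def D0)
qed

section \<open>Derivatives of the Gamma function\<close>

lemma higher_deriv_Gamma_plus1:
  fixes z :: complex
  assumes "z \<notin> \<int>\<^sub>\<le>\<^sub>0"
  shows "(deriv ^^ k) Gamma (z + 1)
    = z * (deriv ^^ k) Gamma z + of_nat k * (deriv ^^ (k - 1)) Gamma z"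
proof -
  let ?S = "- (\<int>\<^sub>\<le>\<^sub>0 :: complex set)"
  have S: "open ?S" by (simp add: open_Compl)
  have holo: "Gamma holomorphic_on ?S" by (intro holomorphic_intros) auto
  have shift: "w + 1 \<in> ?S" if "w \<in> ?S" for w
    using that plus_one_in_nonpos_Ints_imp[of w] by auto
  have "(deriv ^^ k) Gamma (z + 1) = (deriv ^^ k) (\<lambda>w. Gamma (w + 1)) z"
    using higher_deriv_compose_linear'[OF holo S S, of z 1 1 k] shift assms by simp
  also have "\<dots> = (deriv ^^ k) (\<lambda>w. w * Gamma w) z"
    using assms shift
    by (intro higher_deriv_transform_within_open[OF _ _ S])
       (auto intro!: holomorphic_intros Gamma_plus1)
  also have "\<dots> = (\<Sum>i=0..k. of_nat (k choose i) * (deriv ^^ i) (\<lambda>w. w) z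
      * (deriv ^^ (k - i)) Gamma z)"
    using assms by (intro higher_deriv_mult[OF _ holo S]) auto
  \<comment> \<open>Only the first two Leibniz terms survive, since the second derivative of \<open>w\<close> is zero.\<close>
  also have "\<dots> = (\<Sum>i\<in>{0..k} \<inter> {0, 1}. of_nat (k choose i) * (deriv ^^ i) (\<lambda>w. w) z
      * (deriv ^^ (k - i)) Gamma z)"
    by (intro sum.mono_neutral_right) auto
  also have "\<dots> = z * (deriv ^^ k) Gamma z + of_nat k * (deriv ^^ (k - 1)) Gamma z"
    by (cases "k = 0") (auto simp: Int_insert_right)
  finally show ?thesis .
qed

theorem theorem2:
  fixes n :: nat and \<kappa> :: real
  assumes "n \<ge> 1"
    and "\<kappa> \<in> {0<..<1} \<inter> \<rat>"
    and "transcendental (Gamma (of_real \<kappa>))"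
  shows "(finite {z \<in> lattice_plus \<kappa>. algebraic ((deriv ^^ n) Gamma z)} \<and>
          card {z \<in> lattice_plus \<kappa>. algebraic ((deriv ^^ n) Gamma z)} \<le> n) \<and>
         (finite {z \<in> lattice_minus \<kappa>. algebraic ((deriv ^^ n) Gamma z)} \<and>
          card {z \<in> lattice_minus \<kappa>. algebraic ((deriv ^^ n) Gamma z)} \<le> n)"
proof -
  obtain q :: rat where q: "\<kappa> = of_rat q" using assms(2) by (auto elim: Rats_cases)
  have q01: "0 < q" "q < 1" using assms(2) by (auto simp: q)
  have \<kappa>: "complex_of_real \<kappa> = of_rat q" unfolding q by (cases q) (simp add: of_rat_rat)
  obtain \<phi> :: "complex \<Rightarrow> rat" where \<phi>:
    "\<And>y z. \<phi> (y + z) = \<phi> y + \<phi> z" "\<And>r y. \<phi> (of_rat r * y) = r * \<phi> y"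
    "\<And>y. algebraic y \<Longrightarrow> \<phi> y = 0" "\<phi> (Gamma (of_rat q)) = 1"
    using rat_functional_separating_algebraic[OF assms(3)] unfolding \<kappa> by metis
  have \<phi>_nat: "\<phi> (of_nat k * y) = of_nat k * \<phi> y" for k y
    using \<phi>(2)[of "of_nat k" y] by simp
  define U where "U k r = \<phi> ((deriv ^^ k) Gamma (of_rat r))" for k r
  have recurrence: "U k (r + 1) = r * U k r + of_nat k * U (k - 1) r" if "r \<notin> \<int>" for k r
  proof -
    have "(of_rat r :: complex) \<notin> \<int>\<^sub>\<le>\<^sub>0"
    proof
      assume "(of_rat r :: complex) \<in> \<int>\<^sub>\<le>\<^sub>0"
      then obtain j where "of_rat r = (of_rat (of_int j) :: complex)"
        by (auto elim!: nonpos_Ints_cases)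
      then show False using that unfolding of_rat_eq_iff by auto
    qed
    then show ?thesis
      using higher_deriv_Gamma_plus1[of "of_rat r" k]
      by (simp add: U_def of_rat_add \<phi> \<phi>_nat)
  qed
  have nonint: "q + of_int j \<notin> \<int>" for j
  proof
    assume "q + of_int j \<in> \<int>"
    then have "q + of_int j - of_int j \<in> \<int>" by (intro Ints_diff) auto
    then obtain l where "q = of_int l" by (auto elim: Ints_cases)
    then show False using q01 by simp
  qed

  have up: "finite {i. U n (q + of_nat i) = 0} \<and> card {i. U n (q + of_nat i) = 0} \<le> n"
  proof (rule card_zeros_upward_recurrence)
    show "U k (q + of_nat (Suc i)) = (q + of_nat i) * U k (q + of_nat i)
        + of_nat k * U (k - 1) (q + of_nat i)" for k i
      using recurrence[of "q + of_nat i" k] nonint[of "int i"] by (simp add: add_ac)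
  qed (use q01 \<phi>(4) in \<open>auto simp: U_def\<close>)
  have down: "finite {i. U n (q - of_nat i) = 0} \<and> card {i. U n (q - of_nat i) = 0} \<le> n"
  proof (rule card_zeros_downward_recurrence)
    show "U k (q - of_nat i) = (q - of_nat (Suc i)) * U k (q - of_nat (Suc i))
        + of_nat k * U (k - 1) (q - of_nat (Suc i))" for k i
      using recurrence[of "q - of_nat (Suc i)" k] nonint[of "- int (Suc i)"] by simp
  qed (use q01 \<phi>(4) in \<open>auto simp: U_def\<close>)

  have bound: "finite S \<and> card S \<le> n" if "S \<subseteq> f ` Z" "finite Z \<and> card Z \<le> n"
    for S :: "complex set" and f and Z :: "nat set"
    using that surj_card_le[of Z S f] by (auto intro: finite_surj)
  have "{z \<in> lattice_plus \<kappa>. algebraic ((deriv ^^ n) Gamma z)}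
      \<subseteq> (\<lambda>i. of_rat (q + of_nat i)) ` {i. U n (q + of_nat i) = 0}"
    by (auto simp: lattice_plus_def \<kappa> U_def of_rat_add add.commute image_iff intro!: \<phi>(3))
  moreover have "{z \<in> lattice_minus \<kappa>. algebraic ((deriv ^^ n) Gamma z)}
      \<subseteq> (\<lambda>i. of_rat (q - of_nat i)) ` {i. U n (q - of_nat i) = 0}"
    by (auto simp: lattice_minus_def \<kappa> U_def of_rat_diff image_iff intro!: \<phi>(3))
  ultimately show ?thesis
    using bound[OF _ up] bound[OF _ down] by blast
qed

end
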